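(* Let $d\geq 2$ and $k\geq 1$ be integers. For every real $\varepsilon>0$ there is a constant $C_{d,k,\varepsilon}>0$, depending only on $d$, $k$ and $\varepsilon$, such that for every integer $N\geq 2$ and every $\beta\in\mathbb{R}$ there exist integers $b_1,\ldots,b_k$ with $1\leq b_j\leq N$ for all $1\leq j\leq k$ and \[ \left\|\sum_{j=1}^k b_j^{1/d}-\beta\right\|\leq C_{d,k,\varepsilon}\,N^{-k/d+\varepsilon}. \]
   Context: For a real number $x$, $\|x\|$ denotes the distance from $x$ to the nearest integer. For a positive integer $b$, $b^{1/d}$ denotes the positive real $d$-th root. *)

theory Defs
  imports "HOL-Analysis.Analysis"
begin

definition dist_nearest_int :: "real \<Rightarrow> real"
  where "dist_nearest_int x = infdist x \<int>"

end

theory Submission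
  imports Defs
begin

text \<open>Put $w = n^d$ and $\alpha_j = (w - j)^{1/d}$. For positive integers $q_j$ the number $q_j \alpha_j$ is the
$d$-th root of the integer $(w - j) q_j^d$. With $w$ fixed it is therefore enough to approximate $\beta$ modulo $1$
by $\sum_{j=1}^k q_j \alpha_j$ with $q_j \leq Q$, where $Q$ is of order $N^{1/d}$, up to an error
$Q^{-k + \epsilon'}$. For arbitrary fixed algebraic numbers this would be a consequence of Schmidt's subspace
theorem; here $w$ may be chosen large in terms of $d$, $k$ and $\epsilon$, and for such special numbers an
explicit Hermite--Pade construction suffices.

Let $f(t) = (w - t)^{T + 1/d}$. Its divided difference at the nodes $0, \ldots, k$, each taken
$T + 1$ times, is a rational linear combination of $\alpha_0 = n, \alpha_1, \ldots, \alpha_k$. Once denominators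
are cleared, the coefficients are at most $(G w)^{T+1}$, and the value lies between $(G w^k)^{-(T+1)}$ and
$w (G / w^k)^{T+1}$, with $G$ depending only on $d$ and $k$ (lemma \<open>small_linear_form\<close>). Two facts make this
work. All denominators grow only exponentially in $T$ (lemmas \<open>gbinomial_rational_denominator\<close> and
\<open>confluent_divided_difference\<close>). And the value is a series whose terms all have the same
sign (lemma \<open>gbinomial_tail_bounds\<close>), which gives the lower bound as well as the upper one.

The lower bounds allow a greedy expansion of $\beta$ modulo $1$ in the values for
$T = 0, 1, 2, \ldots$ (lemma \<open>ostrowski_expansion\<close>). Consecutive values differ by a factor of about $w^k$, which
bounds the digits. After $R$ steps the coefficients are at most $w^{k+1} (2 G^3 w)^R$ and the
error is at most $w (G / w^k)^R$. When $w$ is so large that $2 G^3 \leq w^\eta$ with small $\eta$, this is an error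
$Q^{-k + O(\eta)}$ at height $Q$, and it remains to choose $R$ maximal for the given $N$.\<close>

section \<open>Binomial coefficients with rational upper index\<close>

text \<open>Write $B_m(i)$ for the binomial coefficient with upper index $m/d$. Vandermonde's identity for
$(m+1)/d = 1/d + m/d$ expresses $B_{m+1}(i) - B_1(i) - B_m(i)$ through products $B_1(r) B_m(i-r)$ with
$0 < r < i$, whose denominators divide $d^{2r-1} d^{2(i-r)-1} = d^{2i-2}$. Hence
$B_m(i) - m B_1(i)$ has denominator $d^{2i-2}$ for all $m$; as $B_d(i)$ is an integer, dividing by $m = d$
gives $B_1(i)$ the denominator $d^{2i-1}$, and then every $B_m(i)$.\<close>

lemma gbinomial_rational_denominator:
  fixes d m i :: nat
  assumes "d \<ge> 1" "i \<ge> 1"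
  shows "real d ^ (2 * i - 1) * ((real m / real d) gchoose i) \<in> \<int>"
  using \<open>i \<ge> 1\<close>
proof (induction i arbitrary: m rule: less_induct)
  case (less i)
  define B where "B m r = (real m / real d) gchoose r" for m r :: nat
  define S where "S m = (\<Sum>r\<in>{1..<i}. B 1 r * B m (i - r))" for m
  have B_Suc: "B (Suc m) i = B 1 i + B m i + S m" for m
  proof -
    have "B (Suc m) i = (\<Sum>r=0..i. B 1 r * B m (i - r))"
      unfolding B_def gbinomial_Vandermonde by (simp add: add_divide_distrib)
    also have "{0..i} = insert 0 (insert i {1..<i})"
      using less.prems by auto
    also have "(\<Sum>r\<in>insert 0 (insert i {1..<i}). B 1 r * B m (i - r)) = B 1 i + B m i + S m"
      using less.prems by (simp add: S_def B_def)
    finally show ?thesis .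
  qed
  have S_int: "real d ^ (2 * i - 2) * S m \<in> \<int>" for m
  proof -
    have "real d ^ (2 * i - 2) * (B 1 r * B m (i - r)) \<in> \<int>" if r: "r \<in> {1..<i}" for r
    proof -
      have "2 * i - 2 = (2 * r - 1) + (2 * (i - r) - 1)"
        using r by auto
      hence "real d ^ (2 * i - 2) * (B 1 r * B m (i - r)) =
          (real d ^ (2 * r - 1) * B 1 r) * (real d ^ (2 * (i - r) - 1) * B m (i - r))"
        by (simp only: power_add mult_ac)
      also have "\<dots> \<in> \<int>"
        unfolding B_def using r by (intro Ints_mult less.IH) auto
      finally show ?thesis .
    qed
    thus ?thesis
      unfolding S_def sum_distrib_left by (rule Ints_sum)
  qed
  have diff_int: "real d ^ (2 * i - 2) * (B m i - real m * B 1 i) \<in> \<int>" for m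
  proof (induction m)
    case 0
    show ?case using less.prems by (simp add: B_def gbinomial_0_left)
  next
    case (Suc m)
    have "real d ^ (2 * i - 2) * (B (Suc m) i - real (Suc m) * B 1 i) =
        real d ^ (2 * i - 2) * (B m i - real m * B 1 i) + real d ^ (2 * i - 2) * S m"
      unfolding B_Suc by (simp add: algebra_simps)
    thus ?case using Suc S_int by simp
  qed
  have "B d i = of_nat (1 choose i)"
    using assms(1) by (simp add: B_def binomial_gbinomial)
  hence "real d ^ (2 * i - 2) * B d i \<in> \<int>"
    by simp
  from Ints_diff[OF this diff_int[of d]]
  have dB1: "real d ^ (2 * i - 2) * (real d * B 1 i) \<in> \<int>"
    by (simp add: algebra_simps)
  have exp: "real d ^ (2 * i - 1) = real d ^ (2 * i - 2) * real d"
    using less.prems by (cases i) auto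
  have "real d ^ (2 * i - 1) * B m i =
      real d * (real d ^ (2 * i - 2) * (B m i - real m * B 1 i)) +
      real m * (real d ^ (2 * i - 2) * (real d * B 1 i))"
    unfolding exp by (simp add: algebra_simps)
  also have "\<dots> \<in> \<int>"
    by (rule Ints_add; rule Ints_mult[OF Ints_of_nat]) (fact diff_int dB1)+
  finally show ?case
    by (simp add: B_def)
qed

lemma gbinomial_shifted_denominator:
  assumes "d \<ge> 1"
  shows "real d ^ (2 * i) * ((real T + 1 / real d) gchoose i) \<in> \<int>"
proof (cases "i = 0")
  case False
  have eq: "real T + 1 / real d = real (T * d + 1) / real d"
    using assms by (simp add: field_simps)
  have "real d ^ (2 * i) = real d * real d ^ (2 * i - 1)"
    using False by (cases i) auto
  hence "real d ^ (2 * i) * ((real T + 1 / real d) gchoose i) =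
      real d * (real d ^ (2 * i - 1) * ((real (T * d + 1) / real d) gchoose i))"
    by (simp only: eq mult_ac)
  also have "\<dots> \<in> \<int>"
    using assms False by (intro Ints_mult[OF Ints_of_nat] gbinomial_rational_denominator) auto
  finally show ?thesis .
qed auto

lemma gbinomial_le_two_power:
  fixes s :: real
  assumes "real T \<le> s" "s \<le> real T + 1" "i \<le> Suc T"
  shows "0 \<le> s gchoose i" "s gchoose i \<le> 2 ^ Suc T"
proof -
  show "0 \<le> s gchoose i"
    unfolding gbinomial_prod_rev using assms
    by (intro divide_nonneg_pos prod_nonneg) auto
  have "s gchoose i \<le> real (Suc T) gchoose i"
    unfolding gbinomial_prod_rev using assms
    by (intro divide_right_mono prod_mono) auto
  also have "\<dots> = real (Suc T choose i)"
    by (simp only: binomial_gbinomial)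
  also have "\<dots> \<le> real (2 ^ Suc T)"
    by (subst of_nat_le_iff) (rule binomial_le_pow2)
  finally show "s gchoose i \<le> 2 ^ Suc T"
    by simp
qed

text \<open>The alternating signs $(-1)^m$ and the sign of the binomial coefficient cancel once $m$ exceeds the upper
index $s$, because each further factor $s - m$ is negative. The size follows from
$c_{m+1} = c_m (m - s)/(m + 1)$ with $(m - T)/2 \leq m - s \leq m + 1$: the lower estimate compares
this with the recurrence of $1/\binom{m}{T+1}$, so the loss is only exponential in $m$.\<close>

lemma gbinomial_tail_bounds:
  fixes s \<nu> :: real
  assumes \<nu>: "0 < \<nu>" "\<nu> \<le> 1 / 2" and s: "s = real T + \<nu>" and m: "m \<ge> Suc T"
  defines "c \<equiv> \<lambda>m. (- 1) ^ Suc T * (- 1) ^ m * (s gchoose m)"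
  shows "\<nu> ^ Suc T * (1 / 2) ^ (m - Suc T) / real (m choose Suc T) \<le> c m" and "c m \<le> 1"
proof -
  have "\<nu> ^ Suc T * (1 / 2) ^ (m - Suc T) / real (m choose Suc T) \<le> c m \<and> c m \<le> 1"
    using m
  proof (induction m rule: dec_induct)
    case base
    have c: "c (Suc T) = (\<Prod>i = 0..<Suc T. (s - real i) / real (Suc T - i))"
      unfolding c_def gbinomial_altdef_of_nat by (simp flip: power_add)
    have "\<nu> ^ Suc T = (\<Prod>i = 0..<Suc T. \<nu>)"
      by simp
    also have "\<dots> \<le> (\<Prod>i = 0..<Suc T. (s - real i) / real (Suc T - i))"
    proof (rule prod_mono)
      fix i assume i: "i \<in> {0..<Suc T}"
      have "\<nu> * real (T - i) \<le> 1 * real (T - i)"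
        using \<nu> by (intro mult_right_mono) auto
      thus "0 \<le> \<nu> \<and> \<nu> \<le> (s - real i) / real (Suc T - i)"
        using i \<nu> s by (auto simp: field_simps of_nat_diff Suc_diff_le)
    qed
    finally have 1: "\<nu> ^ Suc T \<le> c (Suc T)"
      by (simp only: c)
    have 2: "c (Suc T) \<le> 1"
      unfolding c
    proof (rule prod_le_1)
      fix i assume i: "i \<in> {0..<Suc T}"
      thus "0 \<le> (s - real i) / real (Suc T - i) \<and> (s - real i) / real (Suc T - i) \<le> 1"
        using \<nu> s by (auto simp: field_simps of_nat_diff Suc_diff_le)
    qed
    show ?case using 1 2 by simp
  next
    case (step m)
    define L where "L m = \<nu> ^ Suc T * (1 / 2) ^ (m - Suc T) / real (m choose Suc T)" for m
    have "real (Suc m) * (s gchoose Suc m) = (s - real m) * (s gchoose m)"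
      using gbinomial_mult_1[of s m] by (simp add: algebra_simps)
    hence "(s gchoose Suc m) = (s - real m) / real (Suc m) * (s gchoose m)"
      by (simp add: field_simps)
    hence "c (Suc m) = - ((s - real m) / real (Suc m)) * c m"
      by (simp add: c_def)
    also have "- ((s - real m) / real (Suc m)) = (real m - s) / real (Suc m)"
      by (subst minus_divide_left) simp
    finally have c_Suc: "c (Suc m) = (real m - s) / real (Suc m) * c m" .
    have "Suc m * (m choose Suc T) = (Suc m - Suc T) * (Suc m choose Suc T)"
      using binomial_absorb_comp[of "Suc m" "Suc T"] by simp
    hence "real (Suc m) * real (m choose Suc T) = real (m - T) * real (Suc m choose Suc T)"
      by (metis diff_Suc_Suc of_nat_mult)
    moreover have "m choose Suc T > 0" "Suc m choose Suc T > 0"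
      using step by (auto simp del: binomial_Suc_Suc)
    moreover have "1 / b = c / d * (1 / a)" if "d * a = c * b" "a > 0" "b > 0" "d > 0"
      for a b c d :: real
    proof -
      have c: "c = d * a / b"
        using that by (simp add: field_simps)
      show ?thesis
        using that(2-4) by (simp add: c)
    qed
    ultimately have ch: "1 / real (Suc m choose Suc T) =
        real (m - T) / real (Suc m) * (1 / real (m choose Suc T))"
      by (metis of_nat_0_less_iff zero_less_Suc)
    have L_Suc: "L (Suc m) = (real (m - T) / 2) / real (Suc m) * L m"
    proof -
      have "L (Suc m) = \<nu> ^ Suc T * (1 / 2) ^ Suc (m - Suc T) * (1 / real (Suc m choose Suc T))"
      proof -
        have "Suc m - Suc T = Suc (m - Suc T)"
          using step.hyps by simp
        thus ?thesis
          unfolding L_def by (simp only: mult_1 times_divide_eq_right mult_1_right)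
      qed
      also have "\<dots> = (real (m - T) / 2) / real (Suc m) * L m"
        unfolding ch L_def by (simp add: algebra_simps)
      finally show ?thesis .
    qed
    have L0: "0 \<le> L m"
      unfolding L_def using \<nu> by simp
    have IH: "L m \<le> c m" "c m \<le> 1"
      using step.IH by (auto simp: L_def)
    have r: "(real (m - T) / 2) / real (Suc m) \<le> (real m - s) / real (Suc m)"
      using step.hyps \<nu> s by (intro divide_right_mono) (auto simp: of_nat_diff)
    have r1: "(real m - s) / real (Suc m) \<le> 1"
      using \<nu> s by (simp add: field_simps)
    have "L (Suc m) \<le> c (Suc m)"
      unfolding L_Suc c_Suc
      using r IH L0 by (intro mult_mono order.trans[OF _ r]) auto
    moreover have "c (Suc m) \<le> 1 * 1"
      unfolding c_Suc using r1 IH L0 by (intro mult_mono) auto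
    ultimately show ?case
      unfolding L_def by simp
  qed
  thus "\<nu> ^ Suc T * (1 / 2) ^ (m - Suc T) / real (m choose Suc T) \<le> c m" and "c m \<le> 1"
    by auto
qed

section \<open>Confluent divided differences at integer nodes\<close>

text \<open>The divided difference of the monomial $t^m$ at the nodes $x_0, \ldots, x_M$, which is the complete
homogeneous symmetric polynomial of degree $m - M$ in the nodes, and $0$ for $m < M$. The recursion
is the Leibniz rule for $t \cdot t^m$; it needs no division, makes nonnegativity evident, and covers repeated
nodes.\<close>

fun moment :: "nat list \<Rightarrow> nat \<Rightarrow> nat" where
  "moment [] m = 0"
| "moment (x # xs) 0 = (if xs = [] then 1 else 0)"
| "moment (x # xs) (Suc m) = x * moment (x # xs) m + moment xs m"

text \<open>By symmetry of divided differences the Leibniz rule may single out the last node just as well as the first.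
Comparing the two versions yields the quotient recursion of the next lemma.\<close>

lemma moment_snoc:
  "moment (xs @ [y]) (Suc m) = y * moment (xs @ [y]) m + moment xs m"
proof -
  have zero: "moment (xs @ [y]) 0 = (if xs = [] then 1 else 0)" for xs
    by (cases xs) auto
  show "moment (xs @ [y]) (Suc m) = y * moment (xs @ [y]) m + moment xs m"
  proof (induction m arbitrary: xs)
    case 0
    show ?case by (cases xs) (auto simp: zero)
  next
    case (Suc m)
    show ?case
    proof (cases xs)
      case (Cons x ys)
      have "moment (xs @ [y]) (Suc (Suc m)) =
          x * moment (xs @ [y]) (Suc m) + moment (ys @ [y]) (Suc m)"
        unfolding Cons append_Cons by (rule moment.simps(3))
      also have "\<dots> = x * (y * moment (xs @ [y]) m + moment xs m)
          + (y * moment (ys @ [y]) m + moment ys m)"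
        using Suc[of xs] Suc[of ys] by simp
      also have "\<dots> = y * (x * moment (xs @ [y]) m + moment (ys @ [y]) m)
          + (x * moment xs m + moment ys m)"
        by (simp add: algebra_simps)
      also have "\<dots> = y * moment (xs @ [y]) (Suc m) + moment xs (Suc m)"
        unfolding Cons by simp
      finally show ?thesis .
    qed simp
  qed
qed

lemma moment_recurrence:
  "real (moment (ys @ [y]) m) - real (moment (x # ys) m) =
     (real y - real x) * real (moment (x # ys @ [y]) m)"
proof -
  have "x * moment (x # ys @ [y]) m + moment (ys @ [y]) m =
      y * moment (x # ys @ [y]) m + moment (x # ys) m"
    using moment_snoc[of "x # ys" y m] by simp
  hence "real x * real (moment (x # ys @ [y]) m) + real (moment (ys @ [y]) m) =
      real y * real (moment (x # ys @ [y]) m) + real (moment (x # ys) m)"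
    by (metis of_nat_add of_nat_mult)
  thus ?thesis by (simp add: algebra_simps)
qed

lemma moment_eq_0: "Suc m < length xs \<Longrightarrow> moment xs m = 0"
  by (induction xs m rule: moment.induct) auto

lemma moment_eq_1: "length xs = Suc m \<Longrightarrow> moment xs m = 1"
  by (induction xs m rule: moment.induct) (auto simp: moment_eq_0)

text \<open>At a node of multiplicity $M + 1$ the divided difference is the Taylor coefficient of order $M$.\<close>

lemma moment_replicate:
  "moment (replicate (Suc M) x) m = (m choose M) * x ^ (m - M)"
proof (induction m arbitrary: M)
  case 0
  show ?case by (cases M) auto
next
  case (Suc m)
  show ?case
  proof (cases M)
    case 0
    thus ?thesis using Suc[of 0] by simp
  next
    case (Suc M')
    have "moment (replicate (Suc M) x) (Suc m) =
        x * ((m choose M) * x ^ (m - M)) + (m choose M') * x ^ (m - M')"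
      using Suc.IH[of M] Suc.IH[of M'] by (simp add: Suc)
    also have "\<dots> = (Suc m choose M) * x ^ (Suc m - M)"
    proof (cases "M \<le> m")
      case True
      hence "m - M' = Suc (m - M)"
        using Suc by auto
      thus ?thesis
        by (simp add: Suc algebra_simps)
    qed (simp add: Suc binomial_eq_0)
    finally show ?thesis .
  qed
qed

lemma moment_mono:
  "list_all2 (\<le>) xs ys \<Longrightarrow> moment xs m \<le> moment ys m"
proof (induction xs m arbitrary: ys rule: moment.induct)
  case (2 x xs)
  thus ?case by (cases ys) auto
next
  case (3 x xs m)
  then obtain y ys' where ys: "ys = y # ys'" "x \<le> y" "list_all2 (\<le>) xs ys'"
    by (cases ys) auto
  show ?case
    using 3 ys by (auto intro!: add_mono mult_mono)
qed auto

lemma moment_le: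
  assumes "set xs \<subseteq> {..k}" "length xs = Suc M"
  shows "moment xs m \<le> (m choose M) * k ^ (m - M)"
proof -
  have "list_all2 (\<le>) xs (replicate (Suc M) k)"
    unfolding list_all2_conv_all_nth using assms
    by (auto simp del: replicate_Suc dest: subsetD[OF _ nth_mem])
  from moment_mono[OF this, of m] show ?thesis
    by (simp only: moment_replicate)
qed

text \<open>The numbers $c_{j,i}$ are the coefficients of the confluent divided difference
$f \mapsto \sum_{j,i} c_{j,i} f^{(i)}(j)/i!$; the last property is its value on monomials, since
$\binom{m}{i} j^{m-i}$ is the $i$-th Taylor coefficient of $t^m$ at $j$. In the recursion
$f[x_0,\ldots,x_{M+1}] = (f[x_1,\ldots,x_{M+1}] - f[x_0,\ldots,x_M])/(x_{M+1} - x_0)$ each of the $M$ steps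
at most doubles the coefficients and divides by a number between $1$ and $k$, hence by a divisor of $k!$.
So both size and denominator stay exponential in $M$, where a common factor $M!$ would be fatal.
Sortedness of the nodes ensures that $x_0 = x_{M+1}$ only if all nodes coincide.\<close>

lemma confluent_divided_difference:
  fixes xs :: "nat list"
  assumes "sorted xs" "set xs \<subseteq> {..k}" "length xs = Suc M"
    and "\<And>j. count_list xs j \<le> Suc n"
  shows "\<exists>c :: nat \<Rightarrow> nat \<Rightarrow> real.
      (\<forall>j i. fact k ^ M * c j i \<in> \<int>) \<and>
      (\<forall>j. (\<Sum>i\<le>n. \<bar>c j i\<bar>) \<le> 2 ^ M) \<and>
      (\<forall>m. (\<Sum>j\<le>k. \<Sum>i\<le>n. c j i * (real (m choose i) * real j ^ (m - i))) = real (moment xs m))"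
  using assms
proof (induction M arbitrary: xs)
  case 0
  then obtain x where xs: "xs = [x]"
    by (auto simp: length_Suc_conv)
  have x: "x \<le> k" using 0 xs by auto
  have mom: "moment [x] m = x ^ m" for m
    by (induction m) auto
  define c :: "nat \<Rightarrow> nat \<Rightarrow> real" where "c j i = (if j = x then if i = 0 then 1 else 0 else 0)" for j i
  have "(\<Sum>i\<le>n. \<bar>c j i\<bar>) \<le> 1" for j
    by (cases "j = x") (simp_all add: c_def if_distrib[of abs] cong: if_cong)
  moreover have "(\<Sum>j\<le>k. \<Sum>i\<le>n. c j i * (real (m choose i) * real j ^ (m - i))) = real (moment xs m)" for m
  proof -
    have "(\<Sum>i\<le>n. c j i * (real (m choose i) * real j ^ (m - i))) = (if j = x then real x ^ m else 0)" for j
      by (cases "j = x") (simp_all add: c_def if_distrib[where f = "\<lambda>t. t * _"] cong: if_cong)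
    thus ?thesis using x by (simp add: xs mom)
  qed
  ultimately show ?case
    by (intro exI[of _ c]) (auto simp: c_def xs)
next
  case (Suc M)
  define x where "x = hd xs"
  define y where "y = last xs"
  define ys where "ys = butlast (tl xs)"
  have xs: "xs = x # ys @ [y]"
    using Suc.prems(3) unfolding x_def y_def ys_def
    by (cases xs rule: rev_cases; cases "butlast xs") auto
  have xy: "x \<le> y" "x \<le> k" "y \<le> k"
    using Suc.prems xs by auto
  show ?case
  proof (cases "x = y")
    case True
    hence rep: "xs = replicate (Suc (Suc M)) x"
      using Suc.prems unfolding xs
      by (intro replicate_eqI) (auto simp: sorted_append intro: antisym)
    have "count_list (replicate r x) x = r" for r
      by (induction r) auto
    hence n: "Suc M \<le> n"
      using Suc.prems(4)[of x] unfolding rep by simp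
    define c :: "nat \<Rightarrow> nat \<Rightarrow> real"
      where "c j i = (if j = x then if i = Suc M then 1 else 0 else 0)" for j i
    have one: "(1::real) \<le> 2 * 2 ^ M"
      using one_le_power[of "2::real" "Suc M"] by simp
    have "(\<Sum>i\<le>n. \<bar>c j i\<bar>) \<le> 2 ^ Suc M" for j
      using one by (cases "j = x") (simp_all add: c_def if_distrib[of abs] cong: if_cong)
    moreover have "(\<Sum>j\<le>k. \<Sum>i\<le>n. c j i * (real (m choose i) * real j ^ (m - i))) = real (moment xs m)" for m
    proof -
      have "(\<Sum>i\<le>n. c j i * (real (m choose i) * real j ^ (m - i))) =
          (if j = x then real (m choose Suc M) * real x ^ (m - Suc M) else 0)" for j
        using n by (cases "j = x") (simp_all add: c_def if_distrib[where f = "\<lambda>t. t * _"] cong: if_cong)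
      thus ?thesis using xy unfolding rep moment_replicate by simp
    qed
    ultimately show ?thesis
      by (intro exI[of _ c]) (auto simp: c_def intro!: Ints_mult Ints_power fact_in_Ints)
  next
    case False
    hence lt: "x < y" using xy by simp
    have prem1: "sorted (ys @ [y])" "set (ys @ [y]) \<subseteq> {..k}" "length (ys @ [y]) = Suc M"
      and prem2: "sorted (x # ys)" "set (x # ys) \<subseteq> {..k}" "length (x # ys) = Suc M"
      using Suc.prems unfolding xs by (auto simp: sorted_append)
    have cnt: "count_list (ys @ [y]) j \<le> count_list xs j" "count_list (x # ys) j \<le> count_list xs j" for j
      unfolding xs by auto
    obtain c1 :: "nat \<Rightarrow> nat \<Rightarrow> real" where c1:
      "\<And>j i. fact k ^ M * c1 j i \<in> \<int>"
      "\<And>j. (\<Sum>i\<le>n. \<bar>c1 j i\<bar>) \<le> 2 ^ M"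
      "\<And>m. (\<Sum>j\<le>k. \<Sum>i\<le>n. c1 j i * (real (m choose i) * real j ^ (m - i))) = real (moment (ys @ [y]) m)"
      using Suc.IH[OF prem1] Suc.prems(4) cnt(1) by (meson order.trans)
    obtain c2 :: "nat \<Rightarrow> nat \<Rightarrow> real" where c2:
      "\<And>j i. fact k ^ M * c2 j i \<in> \<int>"
      "\<And>j. (\<Sum>i\<le>n. \<bar>c2 j i\<bar>) \<le> 2 ^ M"
      "\<And>m. (\<Sum>j\<le>k. \<Sum>i\<le>n. c2 j i * (real (m choose i) * real j ^ (m - i))) = real (moment (x # ys) m)"
      using Suc.IH[OF prem2] Suc.prems(4) cnt(2) by (meson order.trans)
    define c where "c j i = (c1 j i - c2 j i) / real (y - x)" for j i
    have yx: "real (y - x) \<ge> 1" "real (y - x) = real y - real x"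
      using lt by auto
    have "(y - x) dvd fact k"
      using lt xy by (intro dvd_fact) auto
    then obtain z where z: "(fact k :: nat) = (y - x) * z" by blast
    have zr: "(fact k :: real) = real (y - x) * real z"
      using arg_cong[OF z, of real] by (simp only: of_nat_mult of_nat_fact)
    have int: "fact k ^ Suc M * c j i \<in> \<int>" for j i
    proof -
      have "fact k ^ Suc M * c j i = (real (y - x) * real z) * fact k ^ M * c j i"
        by (simp only: power_Suc zr)
      also have "\<dots> = real z * (fact k ^ M * (real (y - x) * c j i))"
        by (simp only: mult_ac)
      also have "real (y - x) * c j i = c1 j i - c2 j i"
        using lt by (simp add: c_def)
      also have "real z * (fact k ^ M * (c1 j i - c2 j i)) =
          real z * (fact k ^ M * c1 j i - fact k ^ M * c2 j i)"
        by (simp only: right_diff_distrib)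
      also have "\<dots> \<in> \<int>"
        using c1(1) c2(1) by (intro Ints_mult[OF Ints_of_nat] Ints_diff)
      finally show ?thesis .
    qed
    have size: "(\<Sum>i\<le>n. \<bar>c j i\<bar>) \<le> 2 ^ Suc M" for j
    proof -
      have "\<bar>c j i\<bar> \<le> \<bar>c1 j i\<bar> + \<bar>c2 j i\<bar>" for i
      proof -
        have "\<bar>c j i\<bar> = \<bar>c1 j i - c2 j i\<bar> / real (y - x)"
          unfolding c_def by simp
        also have "\<dots> \<le> \<bar>c1 j i - c2 j i\<bar> / 1"
          using yx by (intro divide_left_mono) auto
        also have "\<dots> \<le> \<bar>c1 j i\<bar> + \<bar>c2 j i\<bar>"
          using abs_triangle_ineq4[of "c1 j i" "c2 j i"] by simp
        finally show ?thesis .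
      qed
      hence "(\<Sum>i\<le>n. \<bar>c j i\<bar>) \<le> (\<Sum>i\<le>n. \<bar>c1 j i\<bar>) + (\<Sum>i\<le>n. \<bar>c2 j i\<bar>)"
        by (subst sum.distrib[symmetric]) (intro sum_mono)
      thus ?thesis using c1(2)[of j] c2(2)[of j] by simp
    qed
    have mom: "(\<Sum>j\<le>k. \<Sum>i\<le>n. c j i * (real (m choose i) * real j ^ (m - i))) = real (moment xs m)" for m
    proof -
      have "(\<Sum>j\<le>k. \<Sum>i\<le>n. c j i * (real (m choose i) * real j ^ (m - i))) =
        ((\<Sum>j\<le>k. \<Sum>i\<le>n. c1 j i * (real (m choose i) * real j ^ (m - i))) -
         (\<Sum>j\<le>k. \<Sum>i\<le>n. c2 j i * (real (m choose i) * real j ^ (m - i)))) / real (y - x)"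
        unfolding c_def
        by (simp only: sum_subtractf[symmetric] sum_divide_distrib left_diff_distrib[symmetric]
            times_divide_eq_left)
      also have "\<dots> = real (moment xs m)"
        unfolding c1(3) c2(3) moment_recurrence xs using yx by simp
      finally show ?thesis .
    qed
    show ?thesis
      using int size mom by (intro exI[of _ c] conjI allI)
  qed
qed

section \<open>Small linear forms in roots of consecutive integers\<close>

text \<open>The Taylor coefficient of order $i$ of $(w - t)^s$ at $t = x$, obtained by differentiating the binomial
series at $0$ termwise; algebraically this is
$\binom{s}{m}\binom{m}{i} = \binom{s}{i}\binom{s-i}{m-i}$.\<close>

lemma binomial_series_derivative:
  fixes s w x :: real
  assumes "\<bar>x\<bar> < w"
  shows "(\<lambda>m. (- 1) ^ m * (s gchoose m) * w powr (s - real m) * (real (m choose i) * x ^ (m - i)))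
      sums ((- 1) ^ i * (s gchoose i) * (w - x) powr (s - real i))"
proof -
  define f where "f m = (- 1) ^ m * (s gchoose m) * w powr (s - real m) *
      (real (m choose i) * x ^ (m - i))" for m
  have "(\<lambda>m. (s - real i gchoose m) * w powr (s - real i - real m) * (- x) ^ m)
      sums (w + - x) powr (s - real i)"
    using assms by (intro gen_binomial_real'') auto
  from sums_mult[OF this, of "(- 1) ^ i * (s gchoose i)"]
  have "(\<lambda>m. (- 1) ^ i * (s gchoose i) *
        ((s - real i gchoose m) * w powr (s - real i - real m) * (- x) ^ m))
      sums ((- 1) ^ i * (s gchoose i) * (w - x) powr (s - real i))"
    by simp
  also have "(\<lambda>m. (- 1) ^ i * (s gchoose i) *
        ((s - real i gchoose m) * w powr (s - real i - real m) * (- x) ^ m)) = (\<lambda>m. f (m + i))"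
  proof
    fix m
    have rev: "(s gchoose (m + i)) * real (m + i choose i) = (s gchoose i) * (s - real i gchoose m)"
      using gbinomial_trinomial_revision[of i "m + i" s] by (simp add: binomial_gbinomial)
    have "f (m + i) = (- 1) ^ (m + i) * ((s gchoose (m + i)) * real (m + i choose i)) *
        w powr (s - real i - real m) * x ^ m"
      by (simp add: f_def algebra_simps)
    also have "\<dots> = (- 1) ^ i * (s gchoose i) *
        ((s - real i gchoose m) * w powr (s - real i - real m) * (- x) ^ m)"
      unfolding rev power_minus[of x m] by (simp add: power_add mult_ac)
    finally show "(- 1) ^ i * (s gchoose i) *
        ((s - real i gchoose m) * w powr (s - real i - real m) * (- x) ^ m) = f (m + i)" ..
  qed
  finally have "(\<lambda>m. f (m + i)) sums ((- 1) ^ i * (s gchoose i) * (w - x) powr (s - real i))" .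
  moreover have "f m = 0" if "m < i" for m
    using that by (simp add: f_def binomial_eq_0)
  ultimately have "f sums ((- 1) ^ i * (s gchoose i) * (w - x) powr (s - real i))"
    by (subst (asm) sums_zero_iff_shift) auto
  thus ?thesis
    by (simp add: f_def[abs_def])
qed

lemma equal_multiplicity_nodes:
  "\<exists>xs :: nat list. sorted xs \<and> set xs \<subseteq> {..k} \<and> length xs = Suc k * t \<and> (\<forall>j. count_list xs j \<le> t)"
proof (induction k)
  case 0
  have "count_list (replicate t (0::nat)) j \<le> t" for j
    using count_le_length[of "replicate t 0" j] by simp
  thus ?case by (intro exI[of _ "replicate t 0"]) auto
next
  case (Suc k)
  then obtain xs where xs: "sorted xs" "set xs \<subseteq> {..k}" "length xs = Suc k * t" "\<And>j. count_list xs j \<le> t"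
    by blast
  have cnt: "count_list (replicate r (Suc k)) j = (if j = Suc k then r else 0)" for r j
    by (induction r) auto
  have "count_list xs (Suc k) = 0"
    using xs(2) by (subst count_list_0_iff) auto
  hence "count_list (xs @ replicate t (Suc k)) j \<le> t" for j
    using xs(4)[of j] by (simp add: cnt)
  thus ?case
    using xs by (intro exI[of _ "xs @ replicate t (Suc k)"]) (auto simp: sorted_append subset_iff le_SucI)
qed

text \<open>An exponential base that dominates everything arising from the denominators and the binomial coefficients.
Only its independence of $w$ and $T$ matters: it becomes negligible against $w$.\<close>

definition growth :: "nat \<Rightarrow> nat \<Rightarrow> nat" where
  "growth d k = fact k ^ Suc k * d\<^sup>2 * 4 ^ (k + 2)"

lemma growth_ge_1: "d > 0 \<Longrightarrow> growth d k \<ge> 1"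
  by (simp add: growth_def Suc_le_eq)

text \<open>With $\alpha_j = (w - j)^{1/d}$ and $f(t) = (w - t)^{T + 1/d}$, the Taylor coefficients of $f$ at $j$ of
order $i \leq T$ are rational multiples of $\alpha_j$, namely
$\pm\binom{T+1/d}{i} (w - j)^{T-i} \alpha_j$. The divided difference $\Phi$ of $f$ at $0, \ldots, k$, each
with multiplicity $T + 1$, is therefore a rational linear form in the $\alpha_j$; multiplying by $D$ clears
the denominators. Its coefficients have size about $w^T$. Its value is the sum of the
$a_m h_m$, where $a_m$ are the Taylor coefficients of $f$ at $0$ and $h_m \geq 0$ the divided differences of the
monomials, which vanish for $m < M$, where $M = (k+1)(T+1) - 1$. All $a_m$ with $m \geq M$ have the
same sign, so nothing cancels: the first term bounds the value from below, and
$h_m \leq \binom{m}{M} k^{m-M}$ bounds it from above by the Taylor coefficient of order $M$ at $k$. Both bounds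
are about $w^{T + 1/d - M} = w^{1/d - k(T+1)}$.\<close>

lemma small_linear_form:
  fixes d k w T :: nat
  assumes d: "d \<ge> 2" and k: "k \<ge> 1" and w: "2 * k \<le> w"
  shows "\<exists>p :: nat \<Rightarrow> int.
      (\<forall>j\<le>k. real_of_int \<bar>p j\<bar> \<le> (real (growth d k) * real w) ^ Suc T) \<and>
      1 / (real (growth d k) * real w ^ k) ^ Suc T
        \<le> (\<Sum>j\<le>k. real_of_int (p j) * root d (real (w - j))) \<and>
      (\<Sum>j\<le>k. real_of_int (p j) * root d (real (w - j)))
        \<le> real w * (real (growth d k) / real w ^ k) ^ Suc T"
proof -
  define G where "G = real (growth d k)"
  define R where "R = Suc T"
  define M where "M = k + Suc k * T"
  define \<nu> where "\<nu> = 1 / real d"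
  define s where "s = real T + \<nu>"
  define W where "W = real w"
  have \<nu>: "0 < \<nu>" "\<nu> \<le> 1 / 2"
    using d by (auto simp: \<nu>_def field_simps)
  have W: "W \<ge> 2" "2 * real k \<le> W" "real k < W" "W - real k \<ge> 1"
    using k w unfolding W_def by linarith+
  have lenM: "Suc k * R = Suc M"
    by (simp add: R_def M_def)
  have MR: "R \<le> M"
    using k by (simp add: R_def M_def)
  have sM: "s - real M = \<nu> - real (k * R)"
    by (simp add: s_def M_def R_def algebra_simps)
  have powr_sM: "x powr (s - real M) = x powr \<nu> / (x ^ k) ^ R" if "x > 0" for x
    unfolding sM powr_diff using powr_realpow[OF that, of "k * R"] by (simp add: power_mult)
  obtain xs :: "nat list" where xs: "sorted xs" "set xs \<subseteq> {..k}" "length xs = Suc M" "\<And>j. count_list xs j \<le> R"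
    using equal_multiplicity_nodes[of k R] lenM by metis
  have "\<And>j. count_list xs j \<le> Suc T"
    using xs(4) by (simp add: R_def)
  from confluent_divided_difference[OF xs(1-3) this]
  obtain c :: "nat \<Rightarrow> nat \<Rightarrow> real" where
      "\<forall>j i. fact k ^ M * c j i \<in> \<int>"
      "\<forall>j. (\<Sum>i\<le>T. \<bar>c j i\<bar>) \<le> 2 ^ M"
      "\<forall>m. (\<Sum>j\<le>k. \<Sum>i\<le>T. c j i * (real (m choose i) * real j ^ (m - i))) = real (moment xs m)"
    by (elim exE conjE)
  note c = this[rule_format]

  \<comment> \<open>The sign $g$ makes the series for $g \Phi$ have nonnegative terms.\<close>
  define a where "a m = (- 1) ^ m * (s gchoose m) * W powr (s - real m)" for m
  define F where "F j i = (- 1) ^ i * (s gchoose i) * (W - real j) powr (s - real i)" for j i :: nat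
  define \<Phi> where "\<Phi> = (\<Sum>j\<le>k. \<Sum>i\<le>T. c j i * F j i)"
  define g :: real where "g = (- 1) ^ R"
  define C where "C m = (- 1) ^ Suc T * (- 1) ^ m * (s gchoose m)" for m
  have series: "(\<lambda>m. a m * (real (m choose i) * real j ^ (m - i))) sums F j i" if "j \<le> k" for i j
    unfolding a_def F_def using W that by (intro binomial_series_derivative) auto
  have "(\<lambda>m. \<Sum>j\<le>k. \<Sum>i\<le>T. c j i * (a m * (real (m choose i) * real j ^ (m - i)))) sums \<Phi>"
    unfolding \<Phi>_def by (intro sums_sum sums_mult series) auto
  also have "(\<lambda>m. \<Sum>j\<le>k. \<Sum>i\<le>T. c j i * (a m * (real (m choose i) * real j ^ (m - i)))) =
      (\<lambda>m. a m * real (moment xs m))"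
    unfolding c(3)[symmetric] by (simp add: sum_distrib_left mult_ac)
  finally have \<Phi>_series: "(\<lambda>m. g * (a m * real (moment xs m))) sums (g * \<Phi>)"
    by (rule sums_mult)
  have ga: "g * a m = C m * W powr (s - real m)" for m
    by (simp add: g_def a_def C_def R_def)
  have C_bounds: "\<nu> ^ R * (1 / 2) ^ (m - R) / real (m choose R) \<le> C m" "C m \<le> 1" if "m \<ge> R" for m
    using gbinomial_tail_bounds[OF \<nu> s_def, of m] that unfolding C_def R_def by auto
  have C_nonneg: "C m \<ge> 0" if "m \<ge> R" for m
    using \<nu> by (intro order.trans[OF _ C_bounds(1)[OF that]]) auto
  have ga_nonneg: "0 \<le> g * a m" if "m \<ge> R" for m
    unfolding ga using C_nonneg[OF that] by simp
  have term_nonneg: "0 \<le> g * (a m * real (moment xs m))" for m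
  proof (cases "m \<ge> M")
    case True
    thus ?thesis using ga_nonneg[of m] MR unfolding mult.assoc[symmetric] by auto
  next
    case False
    thus ?thesis using xs(3) by (simp add: moment_eq_0)
  qed

  have lower: "1 / (real d * 4 ^ Suc k * W ^ k) ^ R \<le> g * \<Phi>"
  proof -
    have "g * (a M * real (moment xs M)) \<le> (\<Sum>m. g * (a m * real (moment xs m)))"
      using sum_le_suminf[OF sums_summable[OF \<Phi>_series], of "{M}"] term_nonneg by simp
    hence main: "C M * W powr (s - real M) \<le> g * \<Phi>"
      using sums_unique[OF \<Phi>_series] xs(3) by (simp add: moment_eq_1 flip: ga)
    have CM: "1 / (real d * 4 ^ Suc k) ^ R \<le> C M"
    proof -
      have "real (M choose R) \<le> real (2 ^ M)"
        by (subst of_nat_le_iff) (rule binomial_le_pow2)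
      hence ch: "real (M choose R) \<le> 2 ^ M" "0 < real (M choose R)"
        using MR by auto
      have "(4 ^ Suc k) ^ R = (4::real) ^ (Suc k * R)"
        by (simp only: power_mult)
      also have "\<dots> \<ge> 4 ^ M"
        unfolding lenM by simp
      finally have "1 / (4 ^ Suc k) ^ R \<le> 1 / (4::real) ^ M"
        by (intro divide_left_mono) auto
      also have "(4::real) ^ M = 2 ^ M * 2 ^ M"
        by (simp flip: power_mult_distrib)
      also have "1 / (2 ^ M * 2 ^ M) \<le> (1 / 2) ^ (M - R) / (2::real) ^ M"
      proof -
        have "(1 / 2) ^ M \<le> (1 / 2 :: real) ^ (M - R)"
          by (intro power_decreasing) auto
        thus ?thesis by (simp add: field_simps)
      qed
      also have "\<dots> \<le> (1 / 2) ^ (M - R) / real (M choose R)"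
        using ch by (intro divide_left_mono) auto
      finally have "\<nu> ^ R * (1 / (4 ^ Suc k) ^ R) \<le> \<nu> ^ R * ((1 / 2) ^ (M - R) / real (M choose R))"
        using \<nu> by (intro mult_left_mono) auto
      also have "\<dots> \<le> C M"
        using C_bounds(1)[OF MR] by simp
      finally show ?thesis
        by (simp add: \<nu>_def power_mult_distrib power_divide)
    qed
    have WM: "1 / (W ^ k) ^ R \<le> W powr (s - real M)"
    proof -
      have "1 \<le> W powr \<nu>"
        using W \<nu> by (intro ge_one_powr_ge_zero) auto
      thus ?thesis
        using W by (simp add: powr_sM divide_right_mono)
    qed
    have "1 / (real d * 4 ^ Suc k * W ^ k) ^ R =
        1 / (real d * 4 ^ Suc k) ^ R * (1 / (W ^ k) ^ R)"
      by (simp only: power_mult_distrib times_divide_times_eq mult_1)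
    also have "\<dots> \<le> C M * W powr (s - real M)"
      using W C_nonneg[OF MR] by (intro mult_mono CM WM) auto
    also note main
    finally show ?thesis .
  qed

  have upper: "g * \<Phi> \<le> W * (2 ^ k / W ^ k) ^ R"
  proof -
    have major: "(\<lambda>m. g * (a m * (real (m choose M) * real k ^ (m - M)))) sums (g * F k M)"
      by (intro sums_mult series) auto
    have "g * (a m * real (moment xs m)) \<le> g * (a m * (real (m choose M) * real k ^ (m - M)))" for m
    proof (cases "m \<ge> M")
      case True
      have "real (moment xs m) \<le> real ((m choose M) * k ^ (m - M))"
        by (subst of_nat_le_iff) (rule moment_le[OF xs(2,3)])
      thus ?thesis
        unfolding mult.assoc[symmetric, of g "a m"] using ga_nonneg[of m] MR True
        by (intro mult_left_mono) auto
    next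
      case False
      thus ?thesis using xs(3) by (simp add: moment_eq_0 binomial_eq_0)
    qed
    from sums_le[OF this \<Phi>_series major] have "g * \<Phi> \<le> g * F k M" .
    also have "g * F k M = C M * (W - real k) powr (s - real M)"
      by (simp add: g_def F_def C_def R_def)
    also have "\<dots> \<le> 1 * (W - real k) powr (s - real M)"
      using C_bounds(2)[OF MR] by (intro mult_right_mono) auto
    also have "\<dots> = (W - real k) powr \<nu> * (1 / (W - real k) ^ (k * R))"
      using W by (simp add: powr_sM power_mult)
    also have "\<dots> \<le> W * (1 / (W / 2) ^ (k * R))"
    proof (intro mult_mono divide_left_mono power_mono)
      have "(W - real k) powr \<nu> \<le> (W - real k) powr 1"
        using W \<nu> by (intro powr_mono) auto
      thus "(W - real k) powr \<nu> \<le> W"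
        using W by simp
    qed (use W in auto)
    also have "1 / (W / 2) ^ (k * R) = (2 ^ k / W ^ k) ^ R"
      by (simp add: power_divide power_mult)
    finally show ?thesis .
  qed

  \<comment> \<open>$k!^M$ clears the $c_{j,i}$, and $d^{2T}$ clears the binomial coefficients of order $i \leq T$.\<close>
  define D where "D = fact k ^ M * real d ^ (2 * T)"
  have D1: "D \<ge> 1"
  proof -
    have "1 * 1 \<le> fact k ^ M * real d ^ (2 * T)"
      using d by (intro mult_mono one_le_power fact_ge_1) auto
    thus ?thesis by (simp add: D_def)
  qed
  have D2: "D \<le> (fact k ^ Suc k * real d ^ 2) ^ R"
  proof -
    have "D \<le> fact k ^ (Suc k * R) * real d ^ (2 * R)"
      unfolding D_def lenM using d by (intro mult_mono power_increasing) (auto simp: R_def)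
    thus ?thesis by (simp only: power_mult power_mult_distrib)
  qed
  define P where "P j = g * D * (\<Sum>i\<le>T. c j i * ((- 1) ^ i * (s gchoose i) * real (w - j) ^ (T - i)))" for j
  have P_int: "P j \<in> \<int>" for j
  proof -
    have "g * D * (c j i * ((- 1) ^ i * (s gchoose i) * real (w - j) ^ (T - i))) \<in> \<int>" if "i \<le> T" for i
    proof -
      have "real d ^ (2 * T) = real d ^ (2 * (T - i)) * real d ^ (2 * i)"
        unfolding power_add[symmetric] using that by (intro arg_cong[of _ _ "power _"]) simp
      hence "g * D * (c j i * ((- 1) ^ i * (s gchoose i) * real (w - j) ^ (T - i))) =
          (g * (- 1) ^ i * real (w - j) ^ (T - i) * real d ^ (2 * (T - i))) * (fact k ^ M * c j i) *
          (real d ^ (2 * i) * (s gchoose i))"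
        unfolding D_def by (simp only: mult_ac)
      also have "\<dots> \<in> \<int>"
      proof (rule Ints_mult[OF Ints_mult])
        show "real d ^ (2 * i) * (s gchoose i) \<in> \<int>"
          using gbinomial_shifted_denominator[of d i T] d unfolding s_def \<nu>_def by simp
        show "g * (- 1) ^ i * real (w - j) ^ (T - i) * real d ^ (2 * (T - i)) \<in> \<int>"
          by (simp add: g_def)
      qed (rule c(1))
      finally show ?thesis .
    qed
    thus ?thesis
      unfolding P_def sum_distrib_left by (intro Ints_sum) auto
  qed
  have G_mono: "fact k ^ Suc k * real d ^ 2 * x \<le> G" if "x \<le> 4 ^ (k + 2)" for x
  proof -
    have "G = fact k ^ Suc k * real d ^ 2 * 4 ^ (k + 2)"
      by (simp add: G_def growth_def)
    thus ?thesis
      using mult_left_mono[OF that, of "fact k ^ Suc k * real d ^ 2"] by simp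
  qed
  have P_size: "\<bar>P j\<bar> \<le> (G * W) ^ R" for j
  proof -
    have "\<bar>P j\<bar> \<le> D * (\<Sum>i\<le>T. \<bar>c j i * ((- 1) ^ i * (s gchoose i) * real (w - j) ^ (T - i))\<bar>)"
    proof -
      have "\<bar>g\<bar> = 1"
        by (simp add: g_def power_abs)
      hence "\<bar>P j\<bar> = D * \<bar>\<Sum>i\<le>T. c j i * ((- 1) ^ i * (s gchoose i) * real (w - j) ^ (T - i))\<bar>"
        using D1 unfolding P_def abs_mult by simp
      also have "\<dots> \<le> D * (\<Sum>i\<le>T. \<bar>c j i * ((- 1) ^ i * (s gchoose i) * real (w - j) ^ (T - i))\<bar>)"
        using D1 by (intro mult_left_mono sum_abs) auto
      finally show ?thesis .
    qed
    also have "\<dots> \<le> D * (\<Sum>i\<le>T. \<bar>c j i\<bar> * (2 ^ R * W ^ R))"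
    proof (intro mult_left_mono sum_mono)
      fix i assume i: "i \<in> {..T}"
      have "0 \<le> s gchoose i" "s gchoose i \<le> 2 ^ R"
        using gbinomial_le_two_power[of T s i] i \<nu> unfolding s_def R_def by auto
      moreover have "real (w - j) ^ (T - i) \<le> W ^ R"
      proof -
        have "real (w - j) ^ (T - i) \<le> W ^ (T - i)"
          by (intro power_mono) (auto simp: W_def)
        also have "\<dots> \<le> W ^ R"
          using W by (intro power_increasing) (auto simp: R_def)
        finally show ?thesis .
      qed
      ultimately have "\<bar>(s gchoose i) * real (w - j) ^ (T - i)\<bar> \<le> 2 ^ R * W ^ R"
        unfolding abs_mult by (intro mult_mono) auto
      thus "\<bar>c j i * ((- 1) ^ i * (s gchoose i) * real (w - j) ^ (T - i))\<bar> \<le> \<bar>c j i\<bar> * (2 ^ R * W ^ R)"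
        unfolding abs_mult by (intro mult_left_mono) (auto simp: power_abs)
    qed (use D1 in auto)
    also have "\<dots> = D * (\<Sum>i\<le>T. \<bar>c j i\<bar>) * (2 ^ R * W ^ R)"
      by (simp add: sum_distrib_right)
    also have "\<dots> \<le> (fact k ^ Suc k * real d ^ 2) ^ R * (2 ^ Suc k) ^ R * (2 ^ R * W ^ R)"
    proof (intro mult_right_mono mult_mono)
      have "(2::real) ^ M \<le> 2 ^ (Suc k * R)"
        unfolding lenM by simp
      thus "(\<Sum>i\<le>T. \<bar>c j i\<bar>) \<le> (2 ^ Suc k) ^ R"
        using c(2)[of j] by (simp only: power_mult)
    qed (use D2 W in \<open>auto intro: sum_nonneg\<close>)
    also have "\<dots> = (fact k ^ Suc k * real d ^ 2 * 2 ^ (k + 2) * W) ^ R"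
      by (simp only: power_mult_distrib[symmetric]) (simp add: mult_ac)
    also have "\<dots> \<le> (G * W) ^ R"
    proof (intro power_mono mult_right_mono)
      have "(2::real) ^ (k + 2) \<le> 4 ^ (k + 2)"
        by (rule power_mono) auto
      thus "fact k ^ Suc k * real d ^ 2 * 2 ^ (k + 2) \<le> G"
        by (rule G_mono)
    qed (use W in auto)
    finally show ?thesis .
  qed
  have P_form: "(\<Sum>j\<le>k. P j * root d (real (w - j))) = D * (g * \<Phi>)"
  proof -
    have "P j * root d (real (w - j)) = g * D * (\<Sum>i\<le>T. c j i * F j i)" if "j \<le> k" for j
    proof -
      have pos: "real (w - j) = W - real j" "W - real j > 0"
        using W that unfolding W_def by auto
      have root: "root d (real (w - j)) = (W - real j) powr \<nu>"
        unfolding pos(1) \<nu>_def using pos(2) d by (intro root_powr_inverse) auto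
      have "F j i = (- 1) ^ i * (s gchoose i) * real (w - j) ^ (T - i) * root d (real (w - j))"
        if "i \<le> T" for i
      proof -
        have "s - real i = real (T - i) + \<nu>"
          using that by (simp add: s_def of_nat_diff)
        hence "(W - real j) powr (s - real i) = (W - real j) ^ (T - i) * (W - real j) powr \<nu>"
          using pos by (simp only: powr_add powr_realpow)
        thus ?thesis
          unfolding F_def root by (simp add: pos(1))
      qed
      thus ?thesis
        unfolding P_def by (simp add: sum_distrib_right sum_distrib_left mult_ac)
    qed
    thus ?thesis
      unfolding \<Phi>_def by (simp add: sum_distrib_left mult_ac)
  qed
  have G_ge: "real d * 4 ^ Suc k \<le> G"
  proof -
    have "1 * (real d ^ 1 * 4 ^ Suc k) \<le> fact k ^ Suc k * (real d ^ 2 * 4 ^ (k + 2))"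
      using d by (intro mult_mono power_increasing one_le_power) auto
    thus ?thesis by (simp add: G_def growth_def)
  qed
  have "0 < real d * 4 ^ Suc k"
    using d by simp
  hence G_pos: "G > 0"
    using G_ge by linarith
  have L_lower: "1 / (G * W ^ k) ^ R \<le> D * (g * \<Phi>)"
  proof -
    have "1 / (G * W ^ k) ^ R \<le> 1 / (real d * 4 ^ Suc k * W ^ k) ^ R"
      using G_ge G_pos W d by (intro divide_left_mono power_mono mult_right_mono mult_pos_pos zero_less_power) auto
    also have "\<dots> \<le> 1 * (g * \<Phi>)"
      using lower by simp
    also have "\<dots> \<le> D * (g * \<Phi>)"
    proof (rule mult_right_mono[OF D1])
      show "0 \<le> g * \<Phi>"
        by (rule order.trans[OF _ lower]) (use W in auto)
    qed
    finally show ?thesis .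
  qed
  have L_upper: "D * (g * \<Phi>) \<le> W * (G / W ^ k) ^ R"
  proof -
    have "D * (g * \<Phi>) \<le> (fact k ^ Suc k * real d ^ 2) ^ R * (W * (2 ^ k / W ^ k) ^ R)"
    proof (rule order.trans)
      show "D * (g * \<Phi>) \<le> D * (W * (2 ^ k / W ^ k) ^ R)"
        using D1 by (intro mult_left_mono upper) auto
      show "D * (W * (2 ^ k / W ^ k) ^ R) \<le> (fact k ^ Suc k * real d ^ 2) ^ R * (W * (2 ^ k / W ^ k) ^ R)"
        using W by (intro mult_right_mono D2) auto
    qed
    also have "\<dots> = W * ((fact k ^ Suc k * real d ^ 2 * 2 ^ k) / W ^ k) ^ R"
      by (simp add: power_mult_distrib power_divide)
    also have "\<dots> \<le> W * (G / W ^ k) ^ R"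
    proof (intro mult_left_mono power_mono divide_right_mono)
      have "(2::real) ^ k \<le> 4 ^ k"
        by (intro power_mono) auto
      also have "\<dots> \<le> 4 ^ (k + 2)"
        by (intro power_increasing) auto
      finally show "fact k ^ Suc k * real d ^ 2 * 2 ^ k \<le> G"
        by (rule G_mono)
    qed (use W in auto)
    finally show ?thesis .
  qed
  have floor_P: "real_of_int \<lfloor>P j\<rfloor> = P j" for j
    using P_int[of j] by (auto elim: Ints_cases)
  show ?thesis
    using P_size L_lower L_upper unfolding P_form[symmetric]
    by (intro exI[of _ "\<lambda>j. \<lfloor>P j\<rfloor>"]) (simp add: floor_P G_def W_def R_def)
qed

section \<open>Inhomogeneous approximation by a greedy expansion\<close>

text \<open>A greedy expansion of $\beta$ in the values $L_0, L_1, \ldots$, as in Ostrowski's numeration from continued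
fractions: the remainder after step $r$ lies in $[0, l_r)$, so the next digit, its integer quotient by $L_r$, is at
most $l_r / L_r$. Here $l$ is $L$ shifted by one place, starting with $l_0 = 1$ because the remainder modulo $1$
is below $1$ at the outset.\<close>

lemma ostrowski_expansion:
  fixes \<alpha> :: "'a \<Rightarrow> real" and p :: "nat \<Rightarrow> 'a \<Rightarrow> int" and L l :: "nat \<Rightarrow> real"
  assumes L: "\<And>r. L r = (\<Sum>j\<in>A. real_of_int (p r j) * \<alpha> j)"
    and pos: "\<And>r. L r > 0"
    and l: "l 0 = 1" "\<And>r. l (Suc r) = L r"
  shows "\<exists>q :: 'a \<Rightarrow> int. \<exists>z :: int.
      (\<forall>j. \<bar>real_of_int (q j)\<bar> \<le> (\<Sum>r<R. l r / L r * \<bar>real_of_int (p r j)\<bar>)) \<and>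
      0 \<le> \<beta> - real_of_int z - (\<Sum>j\<in>A. real_of_int (q j) * \<alpha> j) \<and>
      \<beta> - real_of_int z - (\<Sum>j\<in>A. real_of_int (q j) * \<alpha> j) < l R"
proof (induction R)
  case 0
  have "0 \<le> \<beta> - real_of_int \<lfloor>\<beta>\<rfloor>" "\<beta> - real_of_int \<lfloor>\<beta>\<rfloor> < 1"
    by linarith+
  thus ?case
    by (intro exI[of _ "\<lambda>_. 0"] exI[of _ "\<lfloor>\<beta>\<rfloor>"]) (simp add: l)
next
  case (Suc R)
  then obtain q :: "'a \<Rightarrow> int" and z :: int where
      q: "\<And>j. \<bar>real_of_int (q j)\<bar> \<le> (\<Sum>r<R. l r / L r * \<bar>real_of_int (p r j)\<bar>)"
    and t: "0 \<le> \<beta> - real_of_int z - (\<Sum>j\<in>A. real_of_int (q j) * \<alpha> j)"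
      "\<beta> - real_of_int z - (\<Sum>j\<in>A. real_of_int (q j) * \<alpha> j) < l R"
    by blast
  define t where "t = \<beta> - real_of_int z - (\<Sum>j\<in>A. real_of_int (q j) * \<alpha> j)"
  define c where "c = \<lfloor>t / L R\<rfloor>"
  have "0 \<le> t / L R"
    using t pos[of R] by (simp add: t_def)
  hence "0 \<le> c"
    by (simp add: c_def)
  hence c: "0 \<le> real_of_int c" "real_of_int c \<le> t / L R" "t / L R < real_of_int c + 1"
    unfolding c_def by linarith+
  have cl: "real_of_int c \<le> l R / L R"
    using c(2) t(2) pos[of R] by (fold t_def) (simp add: field_simps)
  have rem: "\<beta> - real_of_int z - (\<Sum>j\<in>A. real_of_int (q j + c * p R j) * \<alpha> j) = t - real_of_int c * L R"
    unfolding t_def L by (simp add: algebra_simps sum.distrib sum_distrib_left)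
  have "0 \<le> t - real_of_int c * L R" "t - real_of_int c * L R < l (Suc R)"
    using c(2,3) pos[of R] by (simp_all add: l field_simps)
  moreover have "\<bar>real_of_int (q j + c * p R j)\<bar> \<le> (\<Sum>r<Suc R. l r / L r * \<bar>real_of_int (p r j)\<bar>)" for j
  proof -
    have "\<bar>real_of_int (q j + c * p R j)\<bar> \<le> \<bar>real_of_int (q j)\<bar> + real_of_int c * \<bar>real_of_int (p R j)\<bar>"
      using c(1) abs_triangle_ineq[of "real_of_int (q j)" "real_of_int c * real_of_int (p R j)"]
      by (simp add: abs_mult)
    also have "\<dots> \<le> (\<Sum>r<R. l r / L r * \<bar>real_of_int (p r j)\<bar>) + l R / L R * \<bar>real_of_int (p R j)\<bar>"
      by (intro add_mono q mult_right_mono cl) auto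
    finally show ?thesis by simp
  qed
  ultimately show ?case
    by (intro exI[of _ "\<lambda>j. q j + c * p R j"] exI[of _ z]) (simp only: rem, simp)
qed

lemma dist_nearest_int_le:
  "dist_nearest_int x \<le> \<bar>x - real_of_int z\<bar>"
  unfolding dist_nearest_int_def using infdist_le[of "real_of_int z" \<int> x] by (simp add: dist_real_def)

text \<open>The forms with $T = 0, 1, \ldots, R - 1$ are expanded greedily. Consecutive values have ratio at most
$w^{k+1} G^{2r+1}$, so the digits are small and their contributions sum to at most
$w^{k+1} (2 G^3 w)^R$. The choice $w = n^d$ makes $\alpha_0 = n$ an integer, so the term with $j = 0$ disappears
modulo $1$ and only $k$ unknowns remain.\<close>

lemma inhomogeneous_approximation:
  fixes d k n R :: nat and \<beta> :: real
  assumes d: "d \<ge> 2" and k: "k \<ge> 1" and n: "2 * k \<le> n ^ d"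
  defines "w \<equiv> n ^ d" and "G \<equiv> growth d k"
  shows "\<exists>q :: nat \<Rightarrow> int.
      (\<forall>j\<le>k. \<bar>q j\<bar> \<le> int (w ^ Suc k * (2 * G ^ 3 * w) ^ R)) \<and>
      dist_nearest_int ((\<Sum>j=1..k. real_of_int (q j) * root d (real (w - j))) - \<beta>)
        \<le> real w * (real G / real w ^ k) ^ R"
proof -
  define \<alpha> where "\<alpha> j = root d (real (w - j))" for j
  have wk: "2 * k \<le> w"
    using n by (simp add: w_def)
  hence w: "real w \<ge> 2"
    using k by linarith
  have G: "real G \<ge> 1"
    using growth_ge_1[of d k] d by (simp add: G_def)
  have "\<exists>p. \<forall>r. (\<forall>j\<le>k. real_of_int \<bar>p r j\<bar> \<le> (real G * real w) ^ Suc r) \<and>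
      1 / (real G * real w ^ k) ^ Suc r \<le> (\<Sum>j\<le>k. real_of_int (p r j) * \<alpha> j) \<and>
      (\<Sum>j\<le>k. real_of_int (p r j) * \<alpha> j) \<le> real w * (real G / real w ^ k) ^ Suc r"
    unfolding \<alpha>_def G_def by (rule choice, rule allI, rule small_linear_form[OF d k wk])
  then obtain p where
      p: "\<And>r j. j \<le> k \<Longrightarrow> real_of_int \<bar>p r j\<bar> \<le> (real G * real w) ^ Suc r"
    and lower: "\<And>r. 1 / (real G * real w ^ k) ^ Suc r \<le> (\<Sum>j\<le>k. real_of_int (p r j) * \<alpha> j)"
    and upper: "\<And>r. (\<Sum>j\<le>k. real_of_int (p r j) * \<alpha> j) \<le> real w * (real G / real w ^ k) ^ Suc r"
    by blast
  define L where "L r = (\<Sum>j\<le>k. real_of_int (p r j) * \<alpha> j)" for r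
  define l where "l r = (case r of 0 \<Rightarrow> 1 | Suc r' \<Rightarrow> L r')" for r
  have pos: "L r > 0" for r
    unfolding L_def using w G by (intro less_le_trans[OF _ lower]) auto
  have l: "l r \<le> real w * (real G / real w ^ k) ^ r" for r
    using w upper by (cases r) (auto simp: l_def L_def)
  obtain q :: "nat \<Rightarrow> int" and z :: int where
      q: "\<And>j. \<bar>real_of_int (q j)\<bar> \<le> (\<Sum>r<R. l r / L r * \<bar>real_of_int (p r j)\<bar>)"
    and rem: "0 \<le> \<beta> - real_of_int z - (\<Sum>j\<le>k. real_of_int (q j) * \<alpha> j)"
      "\<beta> - real_of_int z - (\<Sum>j\<le>k. real_of_int (q j) * \<alpha> j) < l R"
    using ostrowski_expansion[of L p \<alpha> "{..k}" l R \<beta>, OF L_def pos] by (auto simp: l_def)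
  define B where "B = w ^ Suc k * (2 * G ^ 3 * w) ^ R"
  have q_le: "\<bar>q j\<bar> \<le> int B" if j: "j \<le> k" for j
  proof -
    have step: "l r / L r * \<bar>real_of_int (p r j)\<bar> \<le> real w ^ Suc k * (real G ^ 3 * real w) ^ R"
      if r: "r < R" for r
    proof -
      have "1 / L r \<le> (real G * real w ^ k) ^ Suc r"
        using lower[of r] pos[of r] w G unfolding L_def[symmetric] by (simp add: field_simps)
      hence "l r * (1 / L r) \<le> real w * (real G / real w ^ k) ^ r * (real G * real w ^ k) ^ Suc r"
        using l[of r] pos[of r] w by (intro mult_mono) auto
      also have "\<dots> = real w ^ Suc k * real G * (real G ^ 2) ^ r"
        using w by (simp add: power_divide power_mult_distrib field_simps power2_eq_square)
      finally have "l r / L r * \<bar>real_of_int (p r j)\<bar> \<le>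
          (real w ^ Suc k * real G * (real G ^ 2) ^ r) * (real G * real w) ^ Suc r"
        using p[OF j, of r] w G by (intro mult_mono) auto
      also have "\<dots> = real w ^ Suc k * (real G ^ 2 * real w * (real G ^ 3 * real w) ^ r)"
        by (simp add: power_mult_distrib power2_eq_square power3_eq_cube)
      also have "\<dots> \<le> real w ^ Suc k * (real G ^ 3 * real w * (real G ^ 3 * real w) ^ r)"
        using w G by (intro mult_left_mono mult_right_mono power_increasing) auto
      also have "\<dots> = real w ^ Suc k * (real G ^ 3 * real w) ^ Suc r"
        by simp
      also have "\<dots> \<le> real w ^ Suc k * (real G ^ 3 * real w) ^ R"
      proof (intro mult_left_mono power_increasing)
        show "1 \<le> real G ^ 3 * real w"
          using w G mult_mono[of 1 "real G ^ 3" 1 "real w"] by (simp add: one_le_power)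
      qed (use r in auto)
      finally show ?thesis .
    qed
    have "\<bar>real_of_int (q j)\<bar> \<le> (\<Sum>r<R. real w ^ Suc k * (real G ^ 3 * real w) ^ R)"
      by (rule order.trans[OF q sum_mono]) (use step in auto)
    also have "\<dots> = real R * (real w ^ Suc k * (real G ^ 3 * real w) ^ R)"
      by simp
    also have "\<dots> \<le> 2 ^ R * (real w ^ Suc k * (real G ^ 3 * real w) ^ R)"
      using of_nat_less_two_power[of R, where 'a = real] by (intro mult_right_mono) auto
    also have "\<dots> = real B"
      by (simp add: B_def power_mult_distrib)
    finally show ?thesis by linarith
  qed
  have "\<alpha> 0 = real n"
    using d unfolding \<alpha>_def w_def by (simp add: real_root_power_cancel)
  moreover have "{..k} = insert 0 {1..k}"
    by auto
  ultimately have split: "(\<Sum>j\<le>k. real_of_int (q j) * \<alpha> j) =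
      real_of_int (q 0 * int n) + (\<Sum>j=1..k. real_of_int (q j) * \<alpha> j)"
    by simp
  have "dist_nearest_int ((\<Sum>j=1..k. real_of_int (q j) * \<alpha> j) - \<beta>)
      \<le> \<bar>(\<Sum>j=1..k. real_of_int (q j) * \<alpha> j) - \<beta> - real_of_int (- (z + q 0 * int n))\<bar>"
    by (rule dist_nearest_int_le)
  also have "\<dots> \<le> l R"
    using rem unfolding split by simp
  also note l[of R]
  finally show ?thesis
    using q_le unfolding B_def \<alpha>_def by blast
qed

text \<open>Replacing $\beta$ by $\beta - (B+1) \sum_j \alpha_j$, where $B$ bounds the coefficients, shifts every coefficient into
$[1, 3B]$. A positive integer $Q$ then satisfies $Q \alpha_j = ((w - j) Q^d)^{1/d}$, which is a root of an
integer.\<close>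

lemma inhomogeneous_root_sum:
  fixes d k n R :: nat and \<beta> :: real
  assumes d: "d \<ge> 2" and k: "k \<ge> 1" and n: "2 * k \<le> n ^ d"
  defines "w \<equiv> n ^ d" and "G \<equiv> growth d k"
  shows "\<exists>b :: nat \<Rightarrow> nat.
      (\<forall>j\<in>{1..k}. 1 \<le> b j \<and> b j \<le> w * (3 * w ^ Suc k) ^ d * ((2 * G ^ 3 * w) ^ d) ^ R) \<and>
      dist_nearest_int ((\<Sum>j=1..k. root d (real (b j))) - \<beta>) \<le> real w * (real G / real w ^ k) ^ R"
proof -
  define B where "B = w ^ Suc k * (2 * G ^ 3 * w) ^ R"
  define \<alpha> where "\<alpha> j = root d (real (w - j))" for j
  obtain q :: "nat \<Rightarrow> int" where
      q: "\<And>j. j \<le> k \<Longrightarrow> \<bar>q j\<bar> \<le> int B"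
    and dist: "dist_nearest_int ((\<Sum>j=1..k. real_of_int (q j) * \<alpha> j) -
        (\<beta> - (\<Sum>j=1..k. real (Suc B) * \<alpha> j))) \<le> real w * (real G / real w ^ k) ^ R"
    using inhomogeneous_approximation[OF d k n, of R "\<beta> - (\<Sum>j=1..k. real (Suc B) * \<alpha> j)"]
    unfolding B_def \<alpha>_def w_def G_def by blast
  have wk: "k < w"
    using n k unfolding w_def by linarith
  have "G \<ge> 1"
    using growth_ge_1[of d k] d by (simp add: G_def)
  hence B1: "B \<ge> 1"
    using wk unfolding B_def by (simp add: Suc_le_eq)
  define Q where "Q j = nat (q j + int (Suc B))" for j
  define b where "b j = (w - j) * Q j ^ d" for j
  have Q: "1 \<le> Q j" "Q j \<le> 3 * B" "real (Q j) = real_of_int (q j) + real (Suc B)" if "j \<le> k" for j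
    using q[OF that] B1 unfolding Q_def by linarith+
  have b: "1 \<le> b j \<and> b j \<le> w * (3 * B) ^ d" if "j \<in> {1..k}" for j
  proof
    have j: "j \<le> k" "w - j > 0"
      using that wk by auto
    show "1 \<le> b j"
      using Q(1)[OF j(1)] j(2) by (simp add: b_def Suc_le_eq)
    show "b j \<le> w * (3 * B) ^ d"
      unfolding b_def by (intro mult_le_mono power_mono Q(2)[OF j(1)]) auto
  qed
  have root: "root d (real (b j)) = real_of_int (q j) * \<alpha> j + real (Suc B) * \<alpha> j" if "j \<in> {1..k}" for j
  proof -
    have "root d (real (b j)) = \<alpha> j * real (Q j)"
      using d by (simp add: b_def \<alpha>_def real_root_mult real_root_power_cancel)
    thus ?thesis
      using Q(3)[of j] that by (simp add: algebra_simps)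
  qed
  have sum_eq: "(\<Sum>j=1..k. root d (real (b j))) - \<beta> =
      (\<Sum>j=1..k. real_of_int (q j) * \<alpha> j) - (\<beta> - (\<Sum>j=1..k. real (Suc B) * \<alpha> j))"
    using root by (simp add: sum.distrib del: of_nat_Suc)
  have "w * (3 * B) ^ d = w * (3 * w ^ Suc k) ^ d * ((2 * G ^ 3 * w) ^ d) ^ R"
    unfolding B_def by (simp only: power_mult_distrib mult_ac power_mult[symmetric])
  thus ?thesis
    using b dist by (intro exI[of _ b]) (simp only: sum_eq, simp)
qed

section \<open>Sums of roots modulo one\<close>

theorem theorem1p1:
  fixes d k :: nat and \<epsilon> :: real
  assumes "d \<ge> 2" and "k \<ge> 1" and "\<epsilon> > 0"
  shows "\<exists>C::real. C > 0 \<and>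
    (\<forall>N::nat. N \<ge> 2 \<longrightarrow> (\<forall>\<beta>::real.
      \<exists>b :: nat \<Rightarrow> nat. (\<forall>j\<in>{1..k}. 1 \<le> b j \<and> b j \<le> N) \<and>
        dist_nearest_int ((\<Sum>j=1..k. root d (real (b j))) - \<beta>)
          \<le> C * real N powr (- (real k / real d) + \<epsilon>)))"
proof -
  define G where "G = growth d k"
  define H where "H = 2 * G ^ 3"
  \<comment> \<open>The maximum with $0$ covers large $\epsilon$, where the required bound does not decay in $N$.\<close>
  define \<theta> where "\<theta> = max 0 (real k / real d - \<epsilon>)"
  define e where "e = real d * \<theta>"
  \<comment> \<open>$\eta$ solves $\eta - k + (1 + \eta) e = 0$, the equation of exponents behind the decay estimate below.\<close>
  define \<eta> where "\<eta> = (real k - e) / (1 + e)"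
  have e: "0 \<le> e" "e < real k"
    using assms by (auto simp: e_def \<theta>_def max_def field_simps)
  have \<eta>: "\<eta> > 0" "\<eta> - real k + (1 + \<eta>) * e \<le> 0"
    using e by (simp_all add: \<eta>_def field_simps)
  have G1: "G \<ge> 1"
    using growth_ge_1[of d k] assms by (simp add: G_def)
  have GH: "G \<le> H"
    using G1 power_increasing[of 1 3 G] unfolding H_def by simp
  \<comment> \<open>$w$ is so large that $H \leq w^\eta$, and $w \geq 2k$.\<close>
  define n where "n = 2 * k + nat \<lceil>real H powr (1 / \<eta>)\<rceil>"
  define w where "w = n ^ d"
  have nw: "n \<le> w"
    unfolding w_def using assms by (intro self_le_power) (auto simp: n_def)
  have wk: "2 * k \<le> n ^ d"
    using nw by (simp add: n_def w_def)
  have w2: "real w \<ge> 2"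
    using wk assms unfolding w_def by linarith
  have Hw: "real H \<le> real w powr \<eta>"
  proof -
    have "real H powr (1 / \<eta>) \<le> real n"
      unfolding n_def by linarith
    also have "\<dots> \<le> real w"
      using nw by simp
    finally have "(real H powr (1 / \<eta>)) powr \<eta> \<le> real w powr \<eta>"
      using \<eta> by (intro powr_mono2) auto
    thus ?thesis
      using \<eta> GH G1 by (simp add: powr_powr)
  qed
  \<comment> \<open>After $R$ steps all radicands are at most $V Y^R$.\<close>
  define Y where "Y = (H * w) ^ d"
  define V where "V = w * (3 * w ^ Suc k) ^ d"
  have Hw2: "H * w \<ge> 2"
    using w2 GH G1 mult_le_mono[of 1 H 2 w] by simp
  have Y: "Y \<ge> 2"
    using self_le_power[of "H * w" d] Hw2 assms unfolding Y_def by linarith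
  have V: "V \<ge> 1"
    using w2 unfolding V_def by (simp add: Suc_le_eq)
  \<comment> \<open>One further step multiplies the error bound by $G/w^k$ and the bound for the radicands by $Y$;\<close>
  \<comment> \<open>this is the trade-off that yields the exponent $\theta$.\<close>
  have decay: "real G / real w ^ k * real Y powr \<theta> \<le> 1"
  proof -
    have "real G / real w ^ k \<le> real w powr \<eta> / real w powr real k"
      using Hw GH w2 by (intro frac_le) (auto simp: powr_realpow)
    moreover have "real Y powr \<theta> \<le> real w powr ((1 + \<eta>) * e)"
    proof -
      have "real H * real w \<le> real w powr \<eta> * real w powr 1"
        using Hw w2 by (intro mult_mono) auto
      hence "real (H * w) \<le> real w powr (1 + \<eta>)"
        by (simp add: powr_add mult.commute)
      hence "real (H * w) powr e \<le> (real w powr (1 + \<eta>)) powr e"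
        using e by (intro powr_mono2) auto
      moreover have "real (H * w) > 0"
        using Hw2 by linarith
      hence "real Y = real (H * w) powr real d"
        by (simp only: Y_def of_nat_power powr_realpow)
      ultimately show ?thesis
        by (simp add: powr_powr e_def)
    qed
    ultimately have "real G / real w ^ k * real Y powr \<theta> \<le>
        real w powr \<eta> / real w powr real k * real w powr ((1 + \<eta>) * e)"
      by (intro mult_mono) auto
    also have "\<dots> = real w powr (\<eta> - real k + (1 + \<eta>) * e)"
      by (simp add: powr_add powr_diff)
    also have "\<dots> \<le> real w powr 0"
      using w2 \<eta> by (intro powr_mono) auto
    finally show ?thesis using w2 by simp
  qed
  define C where "C = real w * real (V * Y) powr \<theta>"
  have C: "C > 0"
    using w2 V Y by (simp add: C_def)
  have bound: "t \<le> C * real N powr (- (real k / real d) + \<epsilon>)"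
    if "t * real N powr \<theta> \<le> C" "N \<ge> 2" for t :: real and N :: nat
  proof -
    have "t \<le> C * real N powr (- \<theta>)"
      using that by (simp add: powr_minus field_simps)
    also have "\<dots> \<le> C * real N powr (- (real k / real d) + \<epsilon>)"
      using that C by (intro mult_left_mono powr_mono) (auto simp: \<theta>_def)
    finally show ?thesis .
  qed
  have "\<exists>b :: nat \<Rightarrow> nat. (\<forall>j\<in>{1..k}. 1 \<le> b j \<and> b j \<le> N) \<and>
        dist_nearest_int ((\<Sum>j=1..k. root d (real (b j))) - \<beta>)
          \<le> C * real N powr (- (real k / real d) + \<epsilon>)" if N: "N \<ge> 2" for N :: nat and \<beta> :: real
  proof (cases "V \<le> N")
    case False
    \<comment> \<open>For the boundedly many $N < V$ any choice of $b$ will do.\<close>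
    define x where "x = (\<Sum>j=1..k. root d (real ((\<lambda>_. 1) j))) - \<beta>"
    have "dist_nearest_int x \<le> 1"
      using dist_nearest_int_le[of x "\<lfloor>x\<rfloor>"] by linarith
    moreover have "1 * real N powr \<theta> \<le> C"
    proof -
      have "real N \<le> real (V * Y)"
        using False Y mult_le_mono[of N V 1 Y] by (simp flip: of_nat_mult)
      hence "real N powr \<theta> \<le> real (V * Y) powr \<theta>"
        by (intro powr_mono2) (auto simp: \<theta>_def)
      also have "\<dots> \<le> real w * real (V * Y) powr \<theta>"
        using w2 mult_right_mono[of 1 "real w" "real (V * Y) powr \<theta>"] by simp
      finally show ?thesis by (simp add: C_def)
    qed
    ultimately have "dist_nearest_int x \<le> C * real N powr (- (real k / real d) + \<epsilon>)"
      using bound[OF _ N] by (meson order.trans)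
    thus ?thesis
      using N by (intro exI[of _ "\<lambda>_. 1"]) (simp add: x_def)
  next
    case True
    \<comment> \<open>Take the largest $R$ with $V Y^R \leq N$.\<close>
    have "N < 2 ^ N"
      by (rule less_exp)
    also have "\<dots> \<le> Y ^ N"
      using Y by (intro power_mono) auto
    also have "\<dots> \<le> V * Y ^ N"
      using V by simp
    finally have ex: "N < V * Y ^ N" .
    define S where "S = (LEAST S. N < V * Y ^ S)"
    have S: "N < V * Y ^ S"
      unfolding S_def by (rule LeastI[of _ N]) (rule ex)
    have "S \<noteq> 0"
      using S True by (intro notI) simp
    then obtain R where R: "S = Suc R"
      by (cases S) auto
    have NR: "V * Y ^ R \<le> N"
      using not_less_Least[of R "\<lambda>S. N < V * Y ^ S"] R unfolding S_def by simp
    define E where "E = real w * (real G / real w ^ k) ^ R"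
    obtain b :: "nat \<Rightarrow> nat" where
        b: "\<forall>j\<in>{1..k}. 1 \<le> b j \<and> b j \<le> V * Y ^ R"
      and dist: "dist_nearest_int ((\<Sum>j=1..k. root d (real (b j))) - \<beta>) \<le> E"
      using inhomogeneous_root_sum[OF assms(1,2) wk, of R \<beta>]
      unfolding V_def Y_def H_def E_def w_def G_def by blast
    have "E * real N powr \<theta> \<le> C"
    proof -
      have "real N \<le> real (V * Y * Y ^ R)"
        using S R by (simp only: of_nat_le_iff) (simp add: mult_ac)
      hence "real N powr \<theta> \<le> real (V * Y * Y ^ R) powr \<theta>"
        by (intro powr_mono2) (auto simp: \<theta>_def)
      also have "\<dots> = real (V * Y) powr \<theta> * (real Y powr \<theta>) ^ R"
        using Y by (simp add: powr_mult powr_powr mult.commute flip: powr_realpow)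
      finally have "E * real N powr \<theta> \<le> E * (real (V * Y) powr \<theta> * (real Y powr \<theta>) ^ R)"
        unfolding E_def by (intro mult_left_mono) auto
      also have "\<dots> = C * (real G / real w ^ k * real Y powr \<theta>) ^ R"
        by (simp only: E_def C_def power_mult_distrib mult_ac)
      also have "\<dots> \<le> C * 1"
        using decay C by (intro mult_left_mono power_le_one) auto
      finally show ?thesis by simp
    qed
    from order.trans[OF dist bound[OF this N]] show ?thesis
      using b NR by (intro exI[of _ b]) (meson order.trans)
  qed
  with C show ?thesis by blast
qed

end
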